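(* Let $P_6$ be the regular hexagon with vertices $v_j = (\cos\frac{j\pi}{3}, \sin\frac{j\pi}{3})$, $j = 0,\dots,5$. Up to rotations about the origin by $60^\circ$ and $120^\circ$ and axial symmetries with respect to the lines containing $v_0v_3$, $v_1v_4$, $v_2v_5$, the only parallelograms $P \in \mathcal{M}^2$ such that $P \subset P_6 \subset \frac{3}{2}P$ are the following two: the parallelogram with vertices $(1,0)$, $(0,\frac{\sqrt 3}{2})$, $(-1,0)$, $(0,-\frac{\sqrt 3}{2})$, and the parallelogram with vertices $(\frac{5}{6},\frac{\sqrt 3}{6})$, $(-\frac{1}{6},\frac{\sqrt 3}{2})$, $(-\frac{5}{6},-\frac{\sqrt 3}{6})$, $(\frac{1}{6},-\frac{\sqrt 3}{2})$. (Both of these parallelograms do satisfy $P \subset P_6 \subset \frac{3}{2}P$.)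
   Context: $\mathcal{M}^2$ denotes the family of all centrally symmetric convex bodies (compact convex sets with non-empty interior) of the Euclidean plane $E^2$ centered at the origin $o$. For $K \in \mathcal{M}^2$ and $\lambda > 0$, $\lambda K$ is the image of $K$ under the homothety with center $o$ and ratio $\lambda$. *)

theory Defs
  imports "HOL-Analysis.Analysis"
begin

definition symmetric_bodies :: "(real^2) set set" where
  "symmetric_bodies = {K. convex K \<and> compact K \<and> interior K \<noteq> {} \<and> uminus ` K = K}"

definition is_parallelogram :: "(real^2) set \<Rightarrow> bool" where
  "is_parallelogram P \<longleftrightarrow>
     (\<exists>a b c d. \<not> collinear {a, b, c} \<and> a + c = b + d \<and> P = convex hull {a, b, c, d})"

definition homothety :: "real \<Rightarrow> (real^2) set \<Rightarrow> (real^2) set" where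
  "homothety l K = (\<lambda>x. l *\<^sub>R x) ` K"

definition hexagon_vertex :: "nat \<Rightarrow> real^2" where
  "hexagon_vertex j = vector [cos (real j * pi / 3), sin (real j * pi / 3)]"

definition P6 :: "(real^2) set" where
  "P6 = convex hull (hexagon_vertex ` {0..5})"

definition rotation :: "real \<Rightarrow> real^2 \<Rightarrow> real^2" where
  "rotation t x = vector [cos t * x $ 1 - sin t * x $ 2, sin t * x $ 1 + cos t * x $ 2]"

text \<open>Orthogonal reflection in the line through the origin spanned by \<open>u \<noteq> 0\<close>.\<close>

definition axial_symmetry :: "real^2 \<Rightarrow> real^2 \<Rightarrow> real^2" where
  "axial_symmetry u x = (2 * (x \<bullet> u) / (u \<bullet> u)) *\<^sub>R u - x"

text \<open>The line containing the vertices \<open>j\<close> and \<open>j + 3\<close> passes through the origin, so it is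
  spanned by vertex \<open>j\<close>. On subsets of the plane symmetric about the origin, the six maps below
  act as the full symmetry group of the hexagon, so closing the set under composition would not
  change the induced equivalence of such subsets.\<close>

definition hexagon_symmetries :: "(real^2 \<Rightarrow> real^2) set" where
  "hexagon_symmetries =
     {id, rotation (pi / 3), rotation (2 * pi / 3),
      axial_symmetry (hexagon_vertex 0), axial_symmetry (hexagon_vertex 1),
      axial_symmetry (hexagon_vertex 2)}"

definition parallelogram_A :: "(real^2) set" where
  "parallelogram_A = convex hull
     {vector [1, 0], vector [0, sqrt 3 / 2], vector [-1, 0], vector [0, - (sqrt 3 / 2)]}"

definition parallelogram_B :: "(real^2) set" where
  "parallelogram_B = convex hull
     {vector [5 / 6, sqrt 3 / 6], vector [- (1 / 6), sqrt 3 / 2],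
      vector [- (5 / 6), - (sqrt 3 / 6)], vector [1 / 6, - (sqrt 3 / 2)]}"

definition admissible :: "(real^2) set \<Rightarrow> bool" where
  "admissible P \<longleftrightarrow> P \<in> symmetric_bodies \<and> is_parallelogram P \<and>
     P \<subseteq> P6 \<and> P6 \<subseteq> homothety (3 / 2) P"

end

(* Boundedness forces the center of P to be o, so P = conv {p, q, -p, -q}. In the coordinates
   a v_0 + b v_1, give each point the triple (a, b, -a - b): the hexagon is the unit ball of the
   maximum norm of this triple, and its symmetries act as signed permutations of the triple. With
   D the determinant of p and q, the inclusion of P_6 in (3/2) P says |p_i| + |q_i| <= 3/2 |D| for
   i = 1, 2, 3. The maximal coordinates of p and q cannot have the same index, so up to symmetry
   p = m (1-u, u, -1) and q = n (v-1, 1, -v), where |D| = m n (1 - u v). The three inequalities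
   leave only (u, v) = (0, 1/2), (1/2, 0), (1/3, 1/3), and each of them is tight enough there to
   force m = n = 1. *)

theory Submission
  imports Defs
begin

section \<open>Parallelograms in lattice coordinates\<close>

text \<open>Coordinates with respect to the basis \<open>v_0\<close>, \<open>v_1\<close> of adjacent
  hexagon vertices. All vertices of the hexagon and of both target parallelograms get rational
  coordinates.\<close>

definition lat :: "real \<Rightarrow> real \<Rightarrow> real^2" where
  "lat a b = vector [a + b / 2, b * sqrt 3 / 2]"

definition para :: "real^2 \<Rightarrow> real^2 \<Rightarrow> (real^2) set" where
  "para p q = convex hull {p, q, - p, - q}"

lemma vector_eq_iff_2: "(x :: real^2) = y \<longleftrightarrow> x $ 1 = y $ 1 \<and> x $ 2 = y $ 2"
  by (simp add: vec_eq_iff forall_2)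

lemma lat_nth [simp]: "lat a b $ 1 = a + b / 2" "lat a b $ 2 = b * sqrt 3 / 2"
  by (simp_all add: lat_def)

lemma lat_eq_iff [simp]: "lat a b = lat c d \<longleftrightarrow> a = c \<and> b = d"
  by (auto simp: vector_eq_iff_2)

lemma uminus_lat [simp]: "- lat a b = lat (- a) (- b)"
  by (simp add: vector_eq_iff_2 field_simps)

lemma scaleR_lat [simp]: "r *\<^sub>R lat a b = lat (r * a) (r * b)"
  by (simp add: vector_eq_iff_2 field_simps)

lemma add_lat [simp]: "lat a b + lat c d = lat (a + c) (b + d)"
  by (simp add: vector_eq_iff_2 field_simps)

lemma diff_lat [simp]: "lat a b - lat c d = lat (a - c) (b - d)"
  by (simp add: vector_eq_iff_2 field_simps)

lemma lat_zero: "0 = lat 0 0"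
  by (simp add: vector_eq_iff_2)

lemma inner_lat: "lat a b \<bullet> lat c d = a * c + b * d + (a * d + b * c) / 2"
  by (simp add: inner_vec_def sum_2 field_simps)

lemma norm_lat: "norm (lat a b) = sqrt (a\<^sup>2 + a * b + b\<^sup>2)"
  by (simp add: norm_eq_sqrt_inner inner_lat power2_eq_square)

lemma lat_coordinates: "x = lat (x $ 1 - x $ 2 / sqrt 3) (2 * x $ 2 / sqrt 3)"
  by (simp add: vector_eq_iff_2)

lemma obtain_lat:
  obtains a b where "x = lat a b"
  using lat_coordinates by blast

text \<open>The parallelogram is the image of the unit ball of the 1-norm under (s, t) \<mapsto> s p
  + t q; this holds for dependent \<open>p\<close>, \<open>q\<close> as well.\<close>

lemma para_eq: "para p q = {s *\<^sub>R p + t *\<^sub>R q | s t. \<bar>s\<bar> + \<bar>t\<bar> \<le> 1}" (is "_ = ?S")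
proof
  have "convex ?S"
  proof (rule convexI)
    fix x y u v :: real and X Y assume X: "X \<in> ?S" and Y: "Y \<in> ?S"
      and u: "0 \<le> u" "0 \<le> v" "u + v = 1"
    from X obtain s t where X: "X = s *\<^sub>R p + t *\<^sub>R q" "\<bar>s\<bar> + \<bar>t\<bar> \<le> 1" by blast
    from Y obtain s' t' where Y: "Y = s' *\<^sub>R p + t' *\<^sub>R q" "\<bar>s'\<bar> + \<bar>t'\<bar> \<le> 1" by blast
    have "\<bar>u * s + v * s'\<bar> + \<bar>u * t + v * t'\<bar> \<le> u * (\<bar>s\<bar> + \<bar>t\<bar>) + v * (\<bar>s'\<bar> + \<bar>t'\<bar>)"
      using abs_triangle_ineq[of "u * s" "v * s'"] abs_triangle_ineq[of "u * t" "v * t'"] u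
      by (simp add: abs_mult algebra_simps)
    also have "\<dots> \<le> u * 1 + v * 1"
      using X Y u by (intro add_mono mult_left_mono) auto
    finally have "\<bar>u * s + v * s'\<bar> + \<bar>u * t + v * t'\<bar> \<le> 1" using u by simp
    moreover have "u *\<^sub>R X + v *\<^sub>R Y = (u * s + v * s') *\<^sub>R p + (u * t + v * t') *\<^sub>R q"
      unfolding X Y by (simp add: algebra_simps)
    ultimately show "u *\<^sub>R X + v *\<^sub>R Y \<in> ?S" by blast
  qed
  moreover have "{p, q, - p, - q} \<subseteq> ?S"
  proof -
    have "p = 1 *\<^sub>R p + 0 *\<^sub>R q" "q = 0 *\<^sub>R p + 1 *\<^sub>R q"
      "- p = (-1) *\<^sub>R p + 0 *\<^sub>R q" "- q = 0 *\<^sub>R p + (-1) *\<^sub>R q" by simp_all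
    moreover have "\<bar>1::real\<bar> + \<bar>0\<bar> \<le> 1" "\<bar>0::real\<bar> + \<bar>1\<bar> \<le> 1" "\<bar>-1::real\<bar> + \<bar>0\<bar> \<le> 1" "\<bar>0::real\<bar> + \<bar>-1\<bar> \<le> 1"
      by simp_all
    ultimately show ?thesis by blast
  qed
  ultimately show "para p q \<subseteq> ?S" unfolding para_def by (rule hull_minimal[rotated])
next
  show "?S \<subseteq> para p q"
  proof clarify
    fix s t :: real assume st: "\<bar>s\<bar> + \<bar>t\<bar> \<le> 1"
    \<comment> \<open>The signs of \<open>s\<close> and \<open>t\<close> are absorbed into the
      choice of vertex. The weights then become nonnegative, and the missing weight goes to the
      origin, the midpoint of \<open>p\<close> and \<open>- p\<close>.\<close>
    define a where "a = (if s \<ge> 0 then p else - p)"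
    define b where "b = (if t \<ge> 0 then q else - q)"
    have "(1/2) *\<^sub>R p + (1/2) *\<^sub>R (- p) \<in> para p q"
      unfolding para_def by (intro convexD convex_convex_hull hull_inc) auto
    then have "{a, b, 0} \<subseteq> para p q"
      unfolding a_def b_def by (auto simp: para_def hull_inc)
    then have "convex hull {a, b, 0} \<subseteq> para p q"
      by (intro hull_minimal) (auto simp: para_def)
    moreover have "\<bar>s\<bar> *\<^sub>R a + \<bar>t\<bar> *\<^sub>R b + (1 - \<bar>s\<bar> - \<bar>t\<bar>) *\<^sub>R 0 \<in> convex hull {a, b, 0}"
      unfolding convex_hull_3 using st by fastforce
    moreover have "\<bar>s\<bar> *\<^sub>R a + \<bar>t\<bar> *\<^sub>R b + (1 - \<bar>s\<bar> - \<bar>t\<bar>) *\<^sub>R 0 = s *\<^sub>R p + t *\<^sub>R q"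
      by (simp add: a_def b_def)
    ultimately show "s *\<^sub>R p + t *\<^sub>R q \<in> para p q" by auto
  qed
qed

lemma para_commute: "para p q = para q p"
  by (simp add: para_def insert_commute)

lemma para_minus_left: "para (- p) q = para p q"
  by (simp add: para_def insert_commute)

lemma para_minus_right: "para p (- q) = para p q"
  by (simp add: para_def insert_commute)

lemma linear_image_para:
  assumes "linear f"
  shows "f ` para p q = para (f p) (f q)"
  using assms by (simp add: para_def convex_hull_linear_image linear_neg)

lemma parallelogram_A_eq: "parallelogram_A = para (lat 1 0) (lat (-1/2) 1)"
proof -
  have "vector [1, 0] = lat 1 0" "vector [0, sqrt 3 / 2] = lat (-1/2) 1"
    "vector [-1, 0] = lat (-1) 0" "vector [0, - (sqrt 3 / 2)] = lat (1/2) (-1)"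
    by (simp_all add: vector_eq_iff_2)
  then show ?thesis by (simp add: parallelogram_A_def para_def)
qed

lemma parallelogram_B_eq: "parallelogram_B = para (lat (2/3) (1/3)) (lat (-2/3) 1)"
proof -
  have "vector [5/6, sqrt 3 / 6] = lat (2/3) (1/3)" "vector [- (1/6), sqrt 3 / 2] = lat (-2/3) 1"
    "vector [- (5/6), - (sqrt 3 / 6)] = lat (-2/3) (-1/3)" "vector [1/6, - (sqrt 3 / 2)] = lat (2/3) (-1)"
    by (simp_all add: vector_eq_iff_2)
  then show ?thesis by (simp add: parallelogram_B_def para_def)
qed

section \<open>The hexagon\<close>

lemma cos_sin_120: "cos (2 * pi / 3) = - (1/2)" "sin (2 * pi / 3) = sqrt 3 / 2"
  using cos_pi_minus[of "pi/3"] sin_pi_minus[of "pi/3"] by (simp_all add: cos_60 sin_60 field_simps)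

lemma hexagon_vertex_lat:
  "hexagon_vertex 0 = lat 1 0" "hexagon_vertex (Suc 0) = lat 0 1" "hexagon_vertex 2 = lat (-1) 1"
  "hexagon_vertex 3 = lat (-1) 0" "hexagon_vertex 4 = lat 0 (-1)" "hexagon_vertex 5 = lat 1 (-1)"
proof -
  have shift: "hexagon_vertex (j + 3) = - hexagon_vertex j" for j
    by (simp add: vector_eq_iff_2 hexagon_vertex_def add_divide_distrib distrib_right)
  show 0: "hexagon_vertex 0 = lat 1 0"
    by (simp add: vector_eq_iff_2 hexagon_vertex_def)
  show 1: "hexagon_vertex (Suc 0) = lat 0 1"
    by (simp add: vector_eq_iff_2 hexagon_vertex_def cos_60 sin_60)
  show 2: "hexagon_vertex 2 = lat (-1) 1"
    using cos_sin_120 by (simp add: vector_eq_iff_2 hexagon_vertex_def)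
  show "hexagon_vertex 3 = lat (-1) 0" using shift[of 0] 0 by simp
  show "hexagon_vertex 4 = lat 0 (-1)" using shift[of 1] 1 by simp
  show "hexagon_vertex 5 = lat 1 (-1)" using shift[of 2] 2 by simp
qed

lemma P6_eq: "P6 = convex hull {lat 1 0, lat 0 1, lat (-1) 1, lat (-1) 0, lat 0 (-1), lat 1 (-1)}"
proof -
  have "{0..5::nat} = {0, Suc 0, 2, 3, 4, 5}" by auto
  then show ?thesis by (simp add: P6_def hexagon_vertex_lat)
qed

text \<open>Each of the three strips is convex and contains the six vertices, hence contains their
  hull.\<close>

lemma P6_bounds:
  assumes "lat a b \<in> P6"
  shows "\<bar>a\<bar> \<le> 1" "\<bar>b\<bar> \<le> 1" "\<bar>a + b\<bar> \<le> 1"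
proof -
  \<comment> \<open>\<open>f\<close> and \<open>g\<close> read off the two coordinates, so
    \<open>f\<close> and \<open>g\<close> together invert \<open>lat\<close>.\<close>
  define f :: "real^2 \<Rightarrow> real" where "f x = x $ 1 - x $ 2 / sqrt 3" for x
  define g :: "real^2 \<Rightarrow> real" where "g x = 2 * x $ 2 / sqrt 3" for x
  have lin: "linear f" "linear g" "linear (\<lambda>x. f x + g x)"
    by (auto intro!: linearI simp: f_def g_def add_divide_distrib algebra_simps)
  have fg [simp]: "f (lat c d) = c" "g (lat c d) = d" for c d
    by (simp_all add: f_def g_def)
  let ?H = "f -` {-1..1} \<inter> g -` {-1..1} \<inter> (\<lambda>x. f x + g x) -` {-1..1}"
  have "convex ?H"
    by (intro convex_Int convex_linear_vimage lin) auto
  then have "P6 \<subseteq> ?H"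
    unfolding P6_eq by (rule hull_minimal[rotated]) auto
  with assms have "lat a b \<in> ?H" by blast
  then show "\<bar>a\<bar> \<le> 1" "\<bar>b\<bar> \<le> 1" "\<bar>a + b\<bar> \<le> 1" by auto
qed

section \<open>Membership in an enlarged parallelogram\<close>

lemma lat_mem_homothety_para_iff:
  "lat a b \<in> homothety r (para (lat p1 p2) (lat q1 q2)) \<longleftrightarrow>
    (\<exists>s t. a = r * (s * p1 + t * q1) \<and> b = r * (s * p2 + t * q2) \<and> \<bar>s\<bar> + \<bar>t\<bar> \<le> 1)"
proof
  assume "lat a b \<in> homothety r (para (lat p1 p2) (lat q1 q2))"
  then obtain s t where "lat a b = r *\<^sub>R (s *\<^sub>R lat p1 p2 + t *\<^sub>R lat q1 q2)" "\<bar>s\<bar> + \<bar>t\<bar> \<le> 1"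
    unfolding homothety_def para_eq by blast
  then show "\<exists>s t. a = r * (s * p1 + t * q1) \<and> b = r * (s * p2 + t * q2) \<and> \<bar>s\<bar> + \<bar>t\<bar> \<le> 1"
    by (auto simp: lat_eq_iff simp del: mult_cancel_left)
next
  assume "\<exists>s t. a = r * (s * p1 + t * q1) \<and> b = r * (s * p2 + t * q2) \<and> \<bar>s\<bar> + \<bar>t\<bar> \<le> 1"
  then obtain s t where "lat a b = r *\<^sub>R (s *\<^sub>R lat p1 p2 + t *\<^sub>R lat q1 q2)" "\<bar>s\<bar> + \<bar>t\<bar> \<le> 1"
    by auto
  then show "lat a b \<in> homothety r (para (lat p1 p2) (lat q1 q2))"
    unfolding homothety_def para_eq by blast
qed

text \<open>Cramer's rule: the coefficients of the point with respect to \<open>r p\<close> and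
  \<open>r q\<close> are quotients of determinants, and the sum of their absolute values must be at
  most 1.\<close>

lemma lat_mem_homothety_para:
  assumes r: "r > 0" and D: "p1 * q2 - p2 * q1 \<noteq> 0"
  shows "lat a b \<in> homothety r (para (lat p1 p2) (lat q1 q2)) \<longleftrightarrow>
    \<bar>a * q2 - b * q1\<bar> + \<bar>p1 * b - p2 * a\<bar> \<le> r * \<bar>p1 * q2 - p2 * q1\<bar>" (is "?L \<longleftrightarrow> ?R")
proof -
  define D where "D = p1 * q2 - p2 * q1"
  have D0: "\<bar>D\<bar> > 0" using assms by (simp add: D_def)
  have "?L \<longleftrightarrow> \<bar>(a * q2 - b * q1) / (r * D)\<bar> + \<bar>(p1 * b - p2 * a) / (r * D)\<bar> \<le> 1"
  proof
    assume ?L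
    then obtain s t where st: "a = r * (s * p1 + t * q1)" "b = r * (s * p2 + t * q2)"
      and le: "\<bar>s\<bar> + \<bar>t\<bar> \<le> 1" unfolding lat_mem_homothety_para_iff by blast
    have "a * q2 - b * q1 = s * (r * D)" "p1 * b - p2 * a = t * (r * D)"
      unfolding st D_def by (simp_all add: algebra_simps)
    then show "\<bar>(a * q2 - b * q1) / (r * D)\<bar> + \<bar>(p1 * b - p2 * a) / (r * D)\<bar> \<le> 1"
      using le D0 r by simp
  next
    assume le: "\<bar>(a * q2 - b * q1) / (r * D)\<bar> + \<bar>(p1 * b - p2 * a) / (r * D)\<bar> \<le> 1"
    define s where "s = (a * q2 - b * q1) / (r * D)"
    define t where "t = (p1 * b - p2 * a) / (r * D)"
    have st: "s * (r * D) = a * q2 - b * q1" "t * (r * D) = p1 * b - p2 * a"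
      using D0 r by (simp_all add: s_def t_def)
    \<comment> \<open>Both sides are multiplied by \<open>D\<close>, so that \<open>st\<close>
      applies; the nonzero factor is cancelled afterwards.\<close>
    have "D * (r * (s * p1 + t * q1)) = s * (r * D) * p1 + t * (r * D) * q1"
      "D * (r * (s * p2 + t * q2)) = s * (r * D) * p2 + t * (r * D) * q2"
      by (simp_all add: algebra_simps)
    then have "D * (r * (s * p1 + t * q1)) = D * a" "D * (r * (s * p2 + t * q2)) = D * b"
      unfolding st by (simp_all add: D_def algebra_simps)
    then show ?L unfolding lat_mem_homothety_para_iff
      using D0 le[folded s_def t_def] by (intro exI[of _ s] exI[of _ t]) auto
  qed
  also have "\<dots> \<longleftrightarrow> ?R"
    using D0 r unfolding D_def[symmetric]
    by (simp add: abs_mult field_simps flip: add_divide_distrib)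
  finally show ?thesis .
qed

text \<open>Both basis vectors are combinations of \<open>p\<close> and \<open>q\<close>, so the
  identity matrix factors through the matrix of \<open>p\<close> and \<open>q\<close>, and
  determinants multiply.\<close>

lemma homothety_para_determinant:
  assumes "lat 1 0 \<in> homothety r (para (lat p1 p2) (lat q1 q2))"
    and "lat 0 1 \<in> homothety r (para (lat p1 p2) (lat q1 q2))"
  shows "p1 * q2 - p2 * q1 \<noteq> 0"
proof -
  from assms obtain s t s' t' where *: "1 = r * (s * p1 + t * q1)" "0 = r * (s * p2 + t * q2)"
    "0 = r * (s' * p1 + t' * q1)" "1 = r * (s' * p2 + t' * q2)"
    unfolding lat_mem_homothety_para_iff by blast
  have "1 * 1 - 0 * (0::real) = r * r * (s * t' - t * s') * (p1 * q2 - p2 * q1)"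
    by (subst (1) *(1), subst *(4), subst *(2), subst *(3)) (simp add: algebra_simps)
  then show ?thesis by auto
qed

section \<open>The extremal problem\<close>

text \<open>This is the case m = n = 1. Each of \<open>u\<close>, \<open>v\<close> is either 1/2,
  which makes the other one 0, or at most 1/3; if both are at most 1/3, the first inequality forces
  equality.\<close>

lemma unit_solutions:
  fixes u v :: real
  assumes "0 \<le> u" "0 \<le> v" "u \<le> 1" "v \<le> 1"
    and 1: "2 - u - v \<le> 3/2 * (1 - u * v)"
    and 2: "1 + u \<le> 3/2 * (1 - u * v)" and 3: "1 + v \<le> 3/2 * (1 - u * v)"
  shows "(u = 0 \<and> v = 1/2) \<or> (u = 1/2 \<and> v = 0) \<or> (u = 1/3 \<and> v = 1/3)"
proof -
  have *: "v \<le> 1/3" if "v \<noteq> 1/2" "0 \<le> u" "0 \<le> v"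
    and 1: "2 - u - v \<le> 3/2 * (1 - u * v)" and 3: "1 + v \<le> 3/2 * (1 - u * v)" for u v :: real
  proof (rule ccontr)
    assume v: "\<not> v \<le> 1/3"
    have "0 \<le> u * v" using that by simp
    then have "v \<le> 1/2" using that(5) by simp
    then have "v < 1/2" using that(1) by simp
    \<comment> \<open>The two inequalities read 1 - 2v \<le> u (2 - 3v) and 3uv \<le> 1 - 2v.
      Multiplying the first by 3v and inserting the second eliminates \<open>u\<close>.\<close>
    have "3 * v * (1 - 2 * v) \<le> 3 * v * (u * (2 - 3 * v))"
      using that by (intro mult_left_mono) (auto simp: algebra_simps)
    also have "\<dots> = (3 * v * u) * (2 - 3 * v)" by simp
    also have "\<dots> \<le> (1 - 2 * v) * (2 - 3 * v)"
      using that \<open>v < 1/2\<close> by (intro mult_right_mono) (auto simp: algebra_simps)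
    finally have "(1 - 2 * v) * (6 * v - 2) \<le> 0" by (simp add: algebra_simps)
    moreover have "(1 - 2 * v) * (6 * v - 2) > 0" using v \<open>v < 1/2\<close> by (intro mult_pos_pos) auto
    ultimately show False by simp
  qed
  consider "v = 1/2" | "u = 1/2" | "u \<le> 1/3" "v \<le> 1/3"
    using *[of v u] *[of u v] assms by (auto simp: mult.commute)
  then show ?thesis
  proof cases
    case 3
    \<comment> \<open>Together with the first inequality this product gives uv \<ge> 1/9, whereas uv
      is at most u/3 and v/3.\<close>
    have "0 \<le> (1/3 - u) * (1/3 - v)" using 3 by simp
    then have "u + v \<le> 3 * (u * v) + 1/3" by (simp add: algebra_simps)
    moreover have "0 \<le> (1/3 - u) * v" "0 \<le> (1/3 - v) * u" using 3 assms by auto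
    ultimately have "u = 1/3 \<and> v = 1/3" using 1 3 by (simp add: algebra_simps)
    then show ?thesis by simp
  next
    case 1
    with assms have "u * v \<le> 0" "0 \<le> u * v" by auto
    with 1 show ?thesis by simp
  next
    case 2
    with assms have "u * v \<le> 0" "0 \<le> u * v" by auto
    with 2 show ?thesis by simp
  qed
qed

text \<open>The triples behind the inequalities are (x, m - x, -m) and (-y, n, y - n), with
  determinant x n + (m - x) y. Since m, n \<le> 1, shrinking both to unit size only weakens the
  inequalities, which reduces the problem to \<open>unit_solutions\<close>.\<close>

lemma normalized_solutions:
  fixes m n x y :: real
  assumes m: "0 < m" "m \<le> 1" and n: "0 < n" "n \<le> 1" and x: "0 \<le> x" "x \<le> m" and y: "0 \<le> y" "y \<le> n"
    and 1: "x + y \<le> 3/2 * (x * n + (m - x) * y)"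
    and 2: "m - x + n \<le> 3/2 * (x * n + (m - x) * y)"
    and 3: "m + n - y \<le> 3/2 * (x * n + (m - x) * y)"
  shows "m = 1 \<and> n = 1 \<and> ((x = 1 \<and> y = 1/2) \<or> (x = 1/2 \<and> y = 1) \<or> (x = 2/3 \<and> y = 2/3))"
proof -
  define u v where "u = 1 - x / m" and "v = 1 - y / n"
  have xy: "x = m * (1 - u)" "y = n * (1 - v)" using m n by (simp_all add: u_def v_def)
  have uv: "0 \<le> u" "u \<le> 1" "0 \<le> v" "v \<le> 1" using m n x y by (simp_all add: u_def v_def)
  have D: "x * n + (m - x) * y = m * n * (1 - u * v)" unfolding xy by (simp add: algebra_simps)
  \<comment> \<open>As mn is at most m and at most n, the left side is at least mn (a + b), and mn
    can be cancelled.\<close>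
  have scale: "a + b \<le> 3/2 * (1 - u * v)"
    if "m * a + n * b \<le> 3/2 * (m * n * (1 - u * v))" "0 \<le> a" "0 \<le> b" for a b
  proof -
    have "m * n * a \<le> m * a" "m * n * b \<le> n * b"
      using mult_right_mono[of n 1 "m * a"] mult_right_mono[of m 1 "n * b"] m n that
      by (simp_all add: ac_simps)
    then have "(m * n) * (a + b) \<le> (m * n) * (3/2 * (1 - u * v))"
      using that by (simp add: algebra_simps)
    then show ?thesis using m n by (simp add: mult_le_cancel_left)
  qed
  have c: "m * (1 - u) + n * (1 - v) \<le> 3/2 * (m * n * (1 - u * v))"
    "m * u + n * 1 \<le> 3/2 * (m * n * (1 - u * v))" "m * 1 + n * v \<le> 3/2 * (m * n * (1 - u * v))"
    using 1 2 3 unfolding D unfolding xy by (simp_all add: algebra_simps)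
  from scale[OF c(1)] scale[OF c(2)] scale[OF c(3)] uv
  have s: "(u = 0 \<and> v = 1/2) \<or> (u = 1/2 \<and> v = 0) \<or> (u = 1/3 \<and> v = 1/3)"
    by (intro unit_solutions) auto
  have mn: "m * n \<le> m" "m * n \<le> n" using m n by (simp_all add: mult_le_cancel_left1 mult_le_cancel_right1)
  \<comment> \<open>In each case the first inequality bounds a positively weighted sum of m and n by
    the same total weight times mn. Since mn \<le> m and mn \<le> n, equality must hold in
    both.\<close>
  have "m * n = m \<and> m * n = n" using s
  proof (elim disjE conjE)
    assume uv: "u = 0" "v = 1/2"
    have "2 * m + n \<le> 3 * (m * n)" using c(1) unfolding uv by simp
    with mn show ?thesis by (intro conjI; linarith)
  next
    assume uv: "u = 1/2" "v = 0"
    have "m + 2 * n \<le> 3 * (m * n)" using c(1) unfolding uv by simp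
    with mn show ?thesis by (intro conjI; linarith)
  next
    assume uv: "u = 1/3" "v = 1/3"
    have "m + n \<le> 2 * (m * n)" using c(1) unfolding uv by simp
    with mn show ?thesis by (intro conjI; linarith)
  qed
  then have "m = 1" "n = 1" using m n by auto
  with s xy show ?thesis by auto
qed

text \<open>The arguments are the coordinate triples of two adjacent vertices. The last three inequalities place
  the hexagon vertices \<open>v\<^sub>1\<close>, \<open>v\<^sub>0\<close>, \<open>v\<^sub>2\<close> in the parallelogram enlarged by \<open>3/2\<close>.\<close>

definition extremal :: "real \<Rightarrow> real \<Rightarrow> real \<Rightarrow> real \<Rightarrow> real \<Rightarrow> real \<Rightarrow> bool" where
  "extremal p1 p2 p3 q1 q2 q3 \<longleftrightarrow>
    p1 + p2 + p3 = 0 \<and> q1 + q2 + q3 = 0 \<and> p1 * q2 - p2 * q1 \<noteq> 0 \<and>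
    \<bar>p1\<bar> \<le> 1 \<and> \<bar>p2\<bar> \<le> 1 \<and> \<bar>p3\<bar> \<le> 1 \<and> \<bar>q1\<bar> \<le> 1 \<and> \<bar>q2\<bar> \<le> 1 \<and> \<bar>q3\<bar> \<le> 1 \<and>
    \<bar>p1\<bar> + \<bar>q1\<bar> \<le> 3/2 * \<bar>p1 * q2 - p2 * q1\<bar> \<and>
    \<bar>p2\<bar> + \<bar>q2\<bar> \<le> 3/2 * \<bar>p1 * q2 - p2 * q1\<bar> \<and>
    \<bar>p3\<bar> + \<bar>q3\<bar> \<le> 3/2 * \<bar>p1 * q2 - p2 * q1\<bar>"

section \<open>Permutations of the coordinates and sign changes of the vertices\<close>

lemma extremal_swap12:
  assumes "extremal p1 p2 p3 q1 q2 q3"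
  shows "extremal p2 p1 p3 q2 q1 q3"
proof -
  have "p2 * q1 - p1 * q2 = - (p1 * q2 - p2 * q1)" by simp
  then show ?thesis using assms unfolding extremal_def by (auto simp only: abs_minus_cancel)
qed

lemma extremal_swap23:
  assumes "extremal p1 p2 p3 q1 q2 q3"
  shows "extremal p1 p3 p2 q1 q3 q2"
proof -
  have 3: "p3 = - p1 - p2" "q3 = - q1 - q2" using assms by (auto simp: extremal_def)
  \<comment> \<open>Because both triples sum to zero, all three 2 by 2 minors agree up to
    sign.\<close>
  have "p1 * q3 - p3 * q1 = - (p1 * q2 - p2 * q1)" unfolding 3 by (simp add: algebra_simps)
  then show ?thesis using assms unfolding extremal_def by (auto simp only: abs_minus_cancel)
qed

lemma extremal_minus_left:
  assumes "extremal p1 p2 p3 q1 q2 q3"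
  shows "extremal (- p1) (- p2) (- p3) q1 q2 q3"
proof -
  have "(- p1) * q2 - (- p2) * q1 = - (p1 * q2 - p2 * q1)" by simp
  then show ?thesis using assms unfolding extremal_def by (auto simp only: abs_minus_cancel)
qed

lemma extremal_minus_right:
  assumes "extremal p1 p2 p3 q1 q2 q3"
  shows "extremal p1 p2 p3 (- q1) (- q2) (- q3)"
proof -
  have "p1 * (- q2) - p2 * (- q1) = - (p1 * q2 - p2 * q1)" by simp
  then show ?thesis using assms unfolding extremal_def by (auto simp only: abs_minus_cancel)
qed

text \<open>With third coordinates -m and -n, the determinant is a difference of two numbers in
  [0, mn]. Its absolute value d is thus at most mn, hence at most m and at most n, so 2d \<le> m + n
  \<le> 3d/2, which is impossible for d > 0.\<close>

lemma extremal_same_max: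
  assumes E: "extremal p1 p2 p3 q1 q2 q3"
    and p: "\<bar>p1\<bar> \<le> \<bar>p3\<bar>" "\<bar>p2\<bar> \<le> \<bar>p3\<bar>" and q: "\<bar>q1\<bar> \<le> \<bar>q3\<bar>" "\<bar>q2\<bar> \<le> \<bar>q3\<bar>"
  shows False
proof -
  have *: False if E: "extremal p1 p2 p3 q1 q2 q3" and neg: "p3 \<le> 0" "q3 \<le> 0"
    and p: "\<bar>p1\<bar> \<le> \<bar>p3\<bar>" "\<bar>p2\<bar> \<le> \<bar>p3\<bar>" and q: "\<bar>q1\<bar> \<le> \<bar>q3\<bar>" "\<bar>q2\<bar> \<le> \<bar>q3\<bar>"
    for p1 p2 p3 q1 q2 q3
  proof -
    define m n where "m = - p3" and "n = - q3"
    have sum: "p1 + p2 + p3 = 0" "q1 + q2 + q3 = 0" "\<bar>p3\<bar> \<le> 1" "\<bar>q3\<bar> \<le> 1"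
      using E by (simp_all add: extremal_def)
    \<comment> \<open>In a triple with sum zero, the two smaller entries cannot have the sign of the
      entry of largest absolute value.\<close>
    have mn: "p2 = m - p1" "q2 = n - q1" "0 \<le> p1" "p1 \<le> m" "0 \<le> q1" "q1 \<le> n" "m \<le> 1" "n \<le> 1"
      unfolding m_def n_def using sum neg p q by linarith+
    define d where "d = \<bar>p1 * q2 - p2 * q1\<bar>"
    have D: "p1 * q2 - p2 * q1 = p1 * n - m * q1" unfolding mn(1,2) by (simp add: algebra_simps)
    have "p1 * n \<le> m * n" "0 \<le> p1 * n" "m * q1 \<le> m * n" "0 \<le> m * q1"
      using mn by (simp_all add: mult_right_mono mult_left_mono)
    then have "d \<le> m * n" unfolding d_def D by linarith
    moreover have "m * n \<le> m" "m * n \<le> n"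
      using mn mult_left_mono[of n 1 m] mult_right_mono[of m 1 n] by simp_all
    moreover have "m + n \<le> 3/2 * d" "0 < d"
      using E neg by (simp_all add: d_def extremal_def m_def n_def)
    ultimately show False by linarith
  qed
  consider "p3 \<le> 0" "q3 \<le> 0" | "0 \<le> p3" "q3 \<le> 0" | "p3 \<le> 0" "0 \<le> q3" | "0 \<le> p3" "0 \<le> q3"
    by linarith
  then show False
  proof cases
    case 1
    from *[OF E 1 p q] show ?thesis .
  next
    case 2
    show ?thesis by (rule *[OF extremal_minus_left[OF E]]) (use 2 p q in simp_all)
  next
    case 3
    show ?thesis by (rule *[OF extremal_minus_right[OF E]]) (use 3 p q in simp_all)
  next
    case 4
    show ?thesis
      by (rule *[OF extremal_minus_left[OF extremal_minus_right[OF E]]]) (use 4 p q in simp_all)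
  qed
qed

text \<open>The rows correspond to (u, v) = (0, 1/2), (1/2, 0), (1/3, 1/3). The first two lead to
  copies of \<open>parallelogram_A\<close>, the third to \<open>parallelogram_B\<close>.\<close>

definition solution :: "real \<Rightarrow> real \<Rightarrow> real \<Rightarrow> real \<Rightarrow> real \<Rightarrow> real \<Rightarrow> bool" where
  "solution p1 p2 p3 q1 q2 q3 \<longleftrightarrow>
    (p1 = 1 \<and> p2 = 0 \<and> p3 = -1 \<and> q1 = -1/2 \<and> q2 = 1 \<and> q3 = -1/2) \<or>
    (p1 = 1/2 \<and> p2 = 1/2 \<and> p3 = -1 \<and> q1 = -1 \<and> q2 = 1 \<and> q3 = 0) \<or>
    (p1 = 2/3 \<and> p2 = 1/3 \<and> p3 = -1 \<and> q1 = -2/3 \<and> q2 = 1 \<and> q3 = -1/3)"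

text \<open>Replacing \<open>p\<close> or \<open>q\<close> by its negative makes \<open>p3\<close>
  nonpositive and \<open>q2\<close> nonnegative; the four disjuncts record which signs were
  changed.\<close>

lemma extremal_distinct_max:
  assumes E: "extremal p1 p2 p3 q1 q2 q3"
    and p: "\<bar>p1\<bar> \<le> \<bar>p3\<bar>" "\<bar>p2\<bar> \<le> \<bar>p3\<bar>" and q: "\<bar>q1\<bar> \<le> \<bar>q2\<bar>" "\<bar>q3\<bar> \<le> \<bar>q2\<bar>"
  shows "solution p1 p2 p3 q1 q2 q3 \<or> solution (- p1) (- p2) (- p3) q1 q2 q3 \<or>
    solution p1 p2 p3 (- q1) (- q2) (- q3) \<or> solution (- p1) (- p2) (- p3) (- q1) (- q2) (- q3)"
proof -
  have *: "solution p1 p2 p3 q1 q2 q3" if E: "extremal p1 p2 p3 q1 q2 q3" and sgn: "p3 \<le> 0" "0 \<le> q2"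
    and p: "\<bar>p1\<bar> \<le> \<bar>p3\<bar>" "\<bar>p2\<bar> \<le> \<bar>p3\<bar>" and q: "\<bar>q1\<bar> \<le> \<bar>q2\<bar>" "\<bar>q3\<bar> \<le> \<bar>q2\<bar>"
    for p1 p2 p3 q1 q2 q3
  proof -
    define m y where "m = - p3" and "y = - q1"
    have sum: "p1 + p2 + p3 = 0" "q1 + q2 + q3 = 0" "\<bar>p3\<bar> \<le> 1" "\<bar>q2\<bar> \<le> 1"
      using E by (simp_all add: extremal_def)
    have mn: "p3 = - m" "q1 = - y" "p2 = m - p1" "q3 = - (q2 - y)"
      and b: "0 \<le> p1" "p1 \<le> m" "0 \<le> y" "y \<le> q2" "m \<le> 1" "q2 \<le> 1"
      unfolding m_def y_def using sum sgn p q by linarith+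
    \<comment> \<open>With these signs the determinant is a sum of nonnegative terms, so its
      absolute value disappears.\<close>
    have D: "p1 * q2 - p2 * q1 = p1 * q2 + (m - p1) * y" using mn by simp
    have "0 \<le> p1 * q2 + (m - p1) * y" using b by simp
    then have abs: "\<bar>p1 * q2 - p2 * q1\<bar> = p1 * q2 + (m - p1) * y" using D by simp
    have "m \<noteq> 0" using E b mn by (auto simp: extremal_def)
    have "q2 \<noteq> 0" using E b mn by (auto simp: extremal_def)
    have "\<bar>p1\<bar> = p1" "\<bar>p2\<bar> = m - p1" "\<bar>p3\<bar> = m" "\<bar>q1\<bar> = y" "\<bar>q2\<bar> = q2" "\<bar>q3\<bar> = q2 - y"
      using b mn by auto
    then have "p1 + y \<le> 3/2 * (p1 * q2 + (m - p1) * y)"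
      "m - p1 + q2 \<le> 3/2 * (p1 * q2 + (m - p1) * y)"
      "m + q2 - y \<le> 3/2 * (p1 * q2 + (m - p1) * y)"
      using E unfolding extremal_def abs by auto
    then have "m = 1 \<and> q2 = 1 \<and> ((p1 = 1 \<and> y = 1/2) \<or> (p1 = 1/2 \<and> y = 1) \<or> (p1 = 2/3 \<and> y = 2/3))"
      using b \<open>m \<noteq> 0\<close> \<open>q2 \<noteq> 0\<close> by (intro normalized_solutions) auto
    then show ?thesis using mn by (auto simp: solution_def)
  qed
  consider "p3 \<le> 0" "0 \<le> q2" | "0 \<le> p3" "0 \<le> q2" | "p3 \<le> 0" "q2 \<le> 0" | "0 \<le> p3" "q2 \<le> 0"
    by linarith
  then show ?thesis
  proof cases
    case 1
    with *[OF E _ _ p q] show ?thesis by blast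
  next
    case 2
    then have "solution (- p1) (- p2) (- p3) q1 q2 q3"
      by (intro *[OF extremal_minus_left[OF E]]) (use p q in simp_all)
    then show ?thesis by blast
  next
    case 3
    then have "solution p1 p2 p3 (- q1) (- q2) (- q3)"
      by (intro *[OF extremal_minus_right[OF E]]) (use p q in simp_all)
    then show ?thesis by blast
  next
    case 4
    then have "solution (- p1) (- p2) (- p3) (- q1) (- q2) (- q3)"
      by (intro *[OF extremal_minus_left[OF extremal_minus_right[OF E]]]) (use p q in simp_all)
    then show ?thesis by blast
  qed
qed

section \<open>Admissible parallelograms\<close>

lemma symmetric_parallelogram_para:
  assumes "P \<in> symmetric_bodies" "is_parallelogram P"
  obtains p q where "P = para p q"
proof -
  obtain a b c d where abcd: "a + c = b + d" and P: "P = convex hull {a, b, c, d}"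
    using assms(2) by (auto simp: is_parallelogram_def)
  have neg: "- x \<in> P" if "x \<in> P" for x
    using assms(1) that by (auto simp: symmetric_bodies_def)
  define m where "m = a + c"
  have m: "m = b + d" by (simp add: m_def abcd)
  have image_eqs: "m - a = c" "m - b = d" "m - c = a" "m - d = b"
    unfolding m_def using abcd by (simp_all add: algebra_simps)
  \<comment> \<open>The point reflection about m/2 swaps opposite vertices; writing it as an affine
    map lets it pass through the convex hull.\<close>
  have "(\<lambda>x. m + (-1) *\<^sub>R x) ` {a, b, c, d} = {a, b, c, d}"
    using image_eqs by (simp add: insert_commute)
  then have P_eq: "(\<lambda>x. m + (-1) *\<^sub>R x) ` P = P"
    unfolding P convex_hull_affinity[symmetric] by simp
  have shift: "x - m \<in> P" if "x \<in> P" for x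
  proof -
    have "m + (-1) *\<^sub>R x \<in> P" using that P_eq by blast
    from neg[OF this] show ?thesis by simp
  qed
  \<comment> \<open>Point symmetry about both \<open>0\<close> and \<open>m/2\<close> makes \<open>P\<close> invariant under translation by \<open>m\<close>.\<close>
  have iter: "a - real n *\<^sub>R m \<in> P" for n
  proof (induction n)
    case 0
    show ?case by (simp add: P hull_inc)
  next
    case (Suc n)
    from shift[OF this] show ?case by (simp add: algebra_simps)
  qed
  have "bounded P" using assms(1) by (auto simp: symmetric_bodies_def compact_imp_bounded)
  then obtain B where B: "norm x \<le> B" if "x \<in> P" for x by (auto simp: bounded_iff)
  have "m = 0"
  proof (rule ccontr)
    assume "m \<noteq> 0"
    then obtain n where n: "B + norm a < real n * norm m"
      using reals_Archimedean3[of "norm m"] by auto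
    have "real n * norm m = norm (a - (a - real n *\<^sub>R m))" by simp
    also have "\<dots> \<le> norm a + norm (a - real n *\<^sub>R m)" by (rule norm_triangle_ineq4)
    finally show False using n B[OF iter[of n]] by linarith
  qed
  then have "c = - a" "d = - b" using m_def m by (simp_all add: eq_neg_iff_add_eq_0 add.commute)
  then show ?thesis using that[of a b] by (simp add: P para_def)
qed

lemma abs_minus_add: "\<bar>- x - y\<bar> = \<bar>x + y\<bar>" for x y :: real
  by linarith

lemma homothety_1: "homothety 1 P = P"
  by (simp add: homothety_def)

text \<open>Making the membership inequality for ratio 1 strict describes an open set inside the
  parallelogram that contains the origin.\<close>

lemma interior_para:
  assumes D: "p1 * q2 - p2 * q1 \<noteq> 0"
  shows "interior (para (lat p1 p2) (lat q1 q2)) \<noteq> {}"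
proof -
  define f :: "real^2 \<Rightarrow> real" where "f x = x $ 1 - x $ 2 / sqrt 3" for x
  define g :: "real^2 \<Rightarrow> real" where "g x = 2 * x $ 2 / sqrt 3" for x
  let ?U = "{x. \<bar>f x * q2 - g x * q1\<bar> + \<bar>p1 * g x - p2 * f x\<bar> < \<bar>p1 * q2 - p2 * q1\<bar>}"
  have "open ?U"
    unfolding f_def g_def by (intro open_Collect_less continuous_intros) auto
  moreover have "?U \<subseteq> para (lat p1 p2) (lat q1 q2)"
  proof
    fix x assume "x \<in> ?U"
    moreover have "x = lat (f x) (g x)" unfolding f_def g_def by (rule lat_coordinates)
    ultimately show "x \<in> para (lat p1 p2) (lat q1 q2)"
      using lat_mem_homothety_para[OF zero_less_one D, of "f x" "g x"] by (simp add: homothety_1)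
  qed
  ultimately have "?U \<subseteq> interior (para (lat p1 p2) (lat q1 q2))" by (rule interior_maximal[rotated])
  moreover have "0 \<in> ?U" using D by (simp add: f_def g_def)
  ultimately show ?thesis by blast
qed

lemma is_parallelogram_para:
  assumes D: "p1 * q2 - p2 * q1 \<noteq> 0"
  shows "is_parallelogram (para (lat p1 p2) (lat q1 q2))"
proof -
  have "\<not> collinear {lat p1 p2, lat q1 q2, - lat p1 p2}"
  proof
    assume "collinear {lat p1 p2, lat q1 q2, - lat p1 p2}"
    then obtain u where u: "\<exists>c. x - y = c *\<^sub>R u"
      if "x \<in> {lat p1 p2, lat q1 q2, - lat p1 p2}" "y \<in> {lat p1 p2, lat q1 q2, - lat p1 p2}" for x y
      unfolding collinear_def by metis
    obtain u1 u2 where u12: "u = lat u1 u2" by (rule obtain_lat)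
    from u[of "lat p1 p2" "- lat p1 p2"] obtain c where c: "p1 + p1 = c * u1" "p2 + p2 = c * u2"
      by (auto simp: u12)
    from u[of "lat p1 p2" "lat q1 q2"] obtain d where d: "p1 - q1 = d * u1" "p2 - q2 = d * u2"
      by (auto simp: u12)
    \<comment> \<open>Collinearity makes 2p and p - q multiples of one vector \<open>u\<close>, so
      their determinant, which is twice that of \<open>p\<close> and \<open>q\<close> up to sign,
      vanishes.\<close>
    have "2 * (p1 * q2 - p2 * q1) = (p2 + p2) * (p1 - q1) - (p1 + p1) * (p2 - q2)"
      by (simp add: algebra_simps)
    also have "\<dots> = 0" unfolding c d by simp
    finally show False using D by simp
  qed
  then show ?thesis
    unfolding is_parallelogram_def para_def
    by (intro exI[of _ "lat p1 p2"] exI[of _ "lat q1 q2"] exI[of _ "- lat p1 p2"] exI[of _ "- lat q1 q2"])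
      (simp add: lat_zero)
qed

text \<open>Used to verify the two candidates. The inequalities place \<open>v_0\<close>,
  \<open>v_1\<close>, \<open>v_2\<close> in the enlarged parallelogram, and their negatives satisfy
  the same inequalities. \<open>P6_bounds\<close> leads only from membership to bounds, so
  membership of the vertices is assumed.\<close>

lemma admissible_para:
  assumes E: "extremal p1 p2 (- p1 - p2) q1 q2 (- q1 - q2)"
    and P6: "lat p1 p2 \<in> P6" "lat q1 q2 \<in> P6" "- lat p1 p2 \<in> P6" "- lat q1 q2 \<in> P6"
  shows "admissible (para (lat p1 p2) (lat q1 q2))" (is "admissible ?P")
proof -
  have D: "p1 * q2 - p2 * q1 \<noteq> 0" using E by (simp add: extremal_def)
  have "uminus ` ?P = ?P"
    by (simp add: linear_image_para linear_uminus para_minus_left para_minus_right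
        del: uminus_lat)
  moreover have "compact ?P" by (simp add: para_def finite_imp_compact_convex_hull)
  moreover have "convex ?P" by (simp add: para_def)
  ultimately have "?P \<in> symmetric_bodies"
    using interior_para[OF D] by (simp add: symmetric_bodies_def)
  moreover have "?P \<subseteq> P6"
    unfolding para_def by (rule hull_minimal) (use P6 in \<open>auto simp: P6_def\<close>)
  moreover have "P6 \<subseteq> homothety (3/2) ?P"
    unfolding P6_eq
  proof (rule hull_minimal)
    show "convex (homothety (3/2) ?P)"
      unfolding homothety_def by (intro convex_scaling) (simp add: para_def)
    show "{lat 1 0, lat 0 1, lat (-1) 1, lat (-1) 0, lat 0 (-1), lat 1 (-1)} \<subseteq> homothety (3/2) ?P"
      using E D by (auto simp: abs_minus_add lat_mem_homothety_para extremal_def add.commute)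
  qed
  ultimately show ?thesis using is_parallelogram_para[OF D] by (simp add: admissible_def)
qed

lemma admissible_extremal:
  assumes "admissible P"
  obtains p1 p2 q1 q2 where "P = para (lat p1 p2) (lat q1 q2)"
    "extremal p1 p2 (- p1 - p2) q1 q2 (- q1 - q2)"
proof -
  obtain p q where "P = para p q"
    using assms symmetric_parallelogram_para by (auto simp: admissible_def)
  moreover obtain p1 p2 where "p = lat p1 p2" by (rule obtain_lat)
  moreover obtain q1 q2 where "q = lat q1 q2" by (rule obtain_lat)
  ultimately have P: "P = para (lat p1 p2) (lat q1 q2)" by simp
  have sub: "P \<subseteq> P6" "P6 \<subseteq> homothety (3/2) P"
    using assms by (simp_all add: admissible_def)
  have "{lat 1 0, lat 0 1, lat (-1) 1} \<subseteq> P6"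
    unfolding P6_eq by (auto intro: hull_inc)
  then have v: "lat 1 0 \<in> homothety (3/2) P" "lat 0 1 \<in> homothety (3/2) P"
    "lat (-1) 1 \<in> homothety (3/2) P"
    using sub by auto
  \<comment> \<open>This has to come first, since the membership criterion requires a nonzero
    determinant.\<close>
  have D: "p1 * q2 - p2 * q1 \<noteq> 0"
    using v unfolding P by (intro homothety_para_determinant)
  have "lat p1 p2 \<in> P" "lat q1 q2 \<in> P" unfolding P para_def by (auto intro: hull_inc)
  then have "lat p1 p2 \<in> P6" "lat q1 q2 \<in> P6" using sub by auto
  note bounds = P6_bounds[OF this(1)] P6_bounds[OF this(2)]
  have "extremal p1 p2 (- p1 - p2) q1 q2 (- q1 - q2)"
    using D v bounds unfolding P
    by (auto simp: abs_minus_add lat_mem_homothety_para extremal_def add.commute)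
  with P show ?thesis by (rule that)
qed

section \<open>The two candidates, whose vertices lie on the boundary of the hexagon\<close>

lemma lat_edge_mem_P6:
  assumes "0 \<le> t" "t \<le> 1" "x \<in> P6" "y \<in> P6"
  shows "(1 - t) *\<^sub>R x + t *\<^sub>R y \<in> P6"
  using assms by (intro convexD) (auto simp: P6_def)

lemma admissible_A: "admissible parallelogram_A"
proof -
  have v: "lat 1 0 \<in> P6" "lat 0 1 \<in> P6" "lat (-1) 1 \<in> P6" "lat (-1) 0 \<in> P6" "lat 0 (-1) \<in> P6" "lat 1 (-1) \<in> P6"
    unfolding P6_eq by (auto intro: hull_inc)
  show ?thesis
    \<comment> \<open>One pair of vertices consists of hexagon vertices, the other of midpoints of
      opposite edges.\<close>
    unfolding parallelogram_A_eq
    by (rule admissible_para)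
      (use v lat_edge_mem_P6[of "1/2", OF _ _ v(2,3)] lat_edge_mem_P6[of "1/2", OF _ _ v(5,6)]
        in \<open>auto simp: extremal_def\<close>)
qed

lemma admissible_B: "admissible parallelogram_B"
proof -
  have v: "lat 1 0 \<in> P6" "lat 0 1 \<in> P6" "lat (-1) 1 \<in> P6" "lat (-1) 0 \<in> P6" "lat 0 (-1) \<in> P6" "lat 1 (-1) \<in> P6"
    unfolding P6_eq by (auto intro: hull_inc)
  show ?thesis
    \<comment> \<open>All four vertices divide edges of the hexagon in ratio 1:2 or 2:1.\<close>
    unfolding parallelogram_B_eq
    by (rule admissible_para)
      (use lat_edge_mem_P6[of "1/3", OF _ _ v(1,2)] lat_edge_mem_P6[of "2/3", OF _ _ v(2,3)]
        lat_edge_mem_P6[of "1/3", OF _ _ v(4,5)] lat_edge_mem_P6[of "2/3", OF _ _ v(5,6)]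
        in \<open>auto simp: extremal_def\<close>)
qed

section \<open>Classification up to symmetry\<close>

text \<open>On triples (a, b, -a - b) the rotation by 120 degrees is a cyclic shift, and the one by
  60 degrees is a negated cyclic shift.\<close>

lemma rotation_lat:
  "rotation (pi / 3) (lat a b) = lat (- b) (a + b)"
  "rotation (2 * pi / 3) (lat a b) = lat (- a - b) a"
  by (simp_all add: vector_eq_iff_2 rotation_def cos_60 sin_60 cos_sin_120 del: times_divide_eq_left)
    (simp_all add: field_simps)

lemma linear_rotation: "linear (rotation t)"
  by (rule linearI) (simp_all add: vector_eq_iff_2 rotation_def algebra_simps)

lemma axial_symmetry_lat:
  "axial_symmetry (lat a b) (lat c d) =
    (2 * (c * a + d * b + (c * b + d * a) / 2) / (a * a + b * b + a * b)) *\<^sub>R lat a b - lat c d"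
  by (simp add: axial_symmetry_def inner_lat algebra_simps)

text \<open>Symmetries are isometries and \<open>parallelogram_A\<close> has a vertex of norm 1, so this bound
  separates the two solutions.\<close>

lemma norm_lt_1_if_mem_B:
  assumes "x \<in> parallelogram_B"
  shows "norm x < 1"
proof -
  \<comment> \<open>All four vertices have squared norm 7/9, and the ball is convex.\<close>
  have "parallelogram_B \<subseteq> ball 0 1"
    unfolding parallelogram_B_eq para_def
    by (rule hull_minimal) (auto simp: norm_lat power2_eq_square real_sqrt_lt_1_iff)
  with assms show ?thesis by auto
qed

lemma image_A_neq_B:
  assumes "\<phi> \<in> hexagon_symmetries"
  shows "\<phi> ` parallelogram_A \<noteq> parallelogram_B"
proof
  assume "\<phi> ` parallelogram_A = parallelogram_B"
  moreover have "lat 1 0 \<in> parallelogram_A"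
    unfolding parallelogram_A_eq para_def by (simp add: hull_inc)
  ultimately have "norm (\<phi> (lat 1 0)) < 1"
    using norm_lt_1_if_mem_B by blast
  moreover have "norm (\<phi> (lat 1 0)) = 1"
    using assms by (auto simp: hexagon_symmetries_def rotation_lat hexagon_vertex_lat axial_symmetry_lat norm_lat)
  ultimately show False by simp
qed

text \<open>The second assumption lets (a, b) and (c, d) be any two coordinates of the triples in
  any order, which undoes a permutation of the indices. The eighteen combinations yield only six
  parallelograms, all reached by \<open>id\<close> and the two rotations.\<close>

lemma solution_para:
  assumes "solution p1 p2 p3 q1 q2 q3"
    and "(a, b, c, d) = (p1, p2, q1, q2) \<or> (a, b, c, d) = (p1, p3, q1, q3) \<or> (a, b, c, d) = (p2, p1, q2, q1) \<or>
      (a, b, c, d) = (p2, p3, q2, q3) \<or> (a, b, c, d) = (p3, p1, q3, q1) \<or> (a, b, c, d) = (p3, p2, q3, q2)"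
  shows "\<exists>\<phi>\<in>hexagon_symmetries. para (lat a b) (lat c d) = \<phi> ` parallelogram_A \<or>
    para (lat a b) (lat c d) = \<phi> ` parallelogram_B"
proof -
  have mem: "id \<in> hexagon_symmetries" "rotation (pi / 3) \<in> hexagon_symmetries"
    "rotation (2 * pi / 3) \<in> hexagon_symmetries"
    by (simp_all add: hexagon_symmetries_def)
  have im: "id ` parallelogram_A = para (lat 1 0) (lat (-1/2) 1)"
    "rotation (pi / 3) ` parallelogram_A = para (lat 0 1) (lat (-1) (1/2))"
    "rotation (2 * pi / 3) ` parallelogram_A = para (lat (-1) 1) (lat (-1/2) (-1/2))"
    "id ` parallelogram_B = para (lat (2/3) (1/3)) (lat (-2/3) 1)"
    "rotation (pi / 3) ` parallelogram_B = para (lat (-1/3) 1) (lat (-1) (1/3))"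
    "rotation (2 * pi / 3) ` parallelogram_B = para (lat (-1) (2/3)) (lat (-1/3) (-2/3))"
    by (simp_all add: parallelogram_A_eq parallelogram_B_eq linear_image_para linear_rotation rotation_lat)
  let ?P = "para (lat a b) (lat c d)"
  \<comment> \<open>Agreement of the vertex pairs up to order and signs, exactly the freedom under
    which \<open>para\<close> is unchanged.\<close>
  define same where "same p q \<longleftrightarrow> (lat a b = p \<or> lat a b = - p) \<and> (lat c d = q \<or> lat c d = - q) \<or>
    (lat a b = q \<or> lat a b = - q) \<and> (lat c d = p \<or> lat c d = - p)" for p q
  have same: "?P = para p q" if "same p q" for p q
    using that unfolding same_def
    by (elim disjE conjE) (simp_all only: para_minus_left para_minus_right para_commute)
  have "same (lat 1 0) (lat (-1/2) 1) \<or> same (lat 0 1) (lat (-1) (1/2)) \<or>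
    same (lat (-1) 1) (lat (-1/2) (-1/2)) \<or> same (lat (2/3) (1/3)) (lat (-2/3) 1) \<or>
    same (lat (-1/3) 1) (lat (-1) (1/3)) \<or> same (lat (-1) (2/3)) (lat (-1/3) (-2/3))"
    using assms(2,1) unfolding solution_def
    by (elim disjE conjE) (simp_all add: same_def)
  then have "?P = para (lat 1 0) (lat (-1/2) 1) \<or> ?P = para (lat 0 1) (lat (-1) (1/2)) \<or>
    ?P = para (lat (-1) 1) (lat (-1/2) (-1/2)) \<or> ?P = para (lat (2/3) (1/3)) (lat (-2/3) 1) \<or>
    ?P = para (lat (-1/3) 1) (lat (-1) (1/3)) \<or> ?P = para (lat (-1) (2/3)) (lat (-1/3) (-2/3))"
    using same by blast
  then show ?thesis unfolding im[symmetric]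
    by (elim disjE) (rule bexI[OF _ mem(1)] bexI[OF _ mem(2)] bexI[OF _ mem(3)], simp)+
qed

text \<open>The cases are the positions of the largest coordinates of \<open>p\<close> and
  \<open>q\<close>. Equal positions are contradictory; distinct ones are moved to positions 3 and 2
  by a permutation, which \<open>solution_para\<close> then undoes.\<close>

lemma extremal_para:
  assumes E: "extremal p1 p2 p3 q1 q2 q3"
  shows "\<exists>\<phi>\<in>hexagon_symmetries. para (lat p1 p2) (lat q1 q2) = \<phi> ` parallelogram_A \<or>
    para (lat p1 p2) (lat q1 q2) = \<phi> ` parallelogram_B"
    (is "\<exists>\<phi>\<in>_. ?Q \<phi> (para (lat p1 p2) (lat q1 q2))")
proof -
  have *: "\<exists>\<phi>\<in>hexagon_symmetries. ?Q \<phi> (para (lat a b) (lat c d))"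
    if E: "extremal p1 p2 p3 q1 q2 q3"
      and m: "\<bar>p1\<bar> \<le> \<bar>p3\<bar>" "\<bar>p2\<bar> \<le> \<bar>p3\<bar>" "\<bar>q1\<bar> \<le> \<bar>q2\<bar>" "\<bar>q3\<bar> \<le> \<bar>q2\<bar>"
      and perm: "(a, b, c, d) = (p1, p2, q1, q2) \<or> (a, b, c, d) = (p1, p3, q1, q3) \<or>
      (a, b, c, d) = (p2, p1, q2, q1) \<or> (a, b, c, d) = (p2, p3, q2, q3) \<or>
      (a, b, c, d) = (p3, p1, q3, q1) \<or> (a, b, c, d) = (p3, p2, q3, q2)"
    for p1 p2 p3 q1 q2 q3 a b c d
  proof -
    have neg: "para (lat (- a) (- b)) (lat c d) = para (lat a b) (lat c d)"
      "para (lat a b) (lat (- c) (- d)) = para (lat a b) (lat c d)"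
      "para (lat (- a) (- b)) (lat (- c) (- d)) = para (lat a b) (lat c d)"
      using para_minus_left[of "lat a b"] para_minus_right[of _ "lat c d"] by simp_all
    from extremal_distinct_max[OF E m] show ?thesis
    proof (elim disjE)
      assume "solution p1 p2 p3 q1 q2 q3"
      from solution_para[OF this perm] show ?thesis .
    next
      assume "solution (- p1) (- p2) (- p3) q1 q2 q3"
      from solution_para[OF this, of "- a" "- b" c d] perm show ?thesis by (simp add: neg)
    next
      assume "solution p1 p2 p3 (- q1) (- q2) (- q3)"
      from solution_para[OF this, of a b "- c" "- d"] perm show ?thesis by (simp add: neg)
    next
      assume "solution (- p1) (- p2) (- p3) (- q1) (- q2) (- q3)"
      from solution_para[OF this, of "- a" "- b" "- c" "- d"] perm show ?thesis by (simp add: neg)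
    qed
  qed
  \<comment> \<open>With \<open>E\<close> itself these cover all six orders of the indices, hence
    every ordered pair of distinct positions.\<close>
  note E23 = extremal_swap23[OF E] and E12 = extremal_swap12[OF E]
  note E132 = extremal_swap12[OF E23] and E123 = extremal_swap23[OF E12]
  note E13 = extremal_swap12[OF E123]
  consider "\<bar>p1\<bar> \<le> \<bar>p3\<bar>" "\<bar>p2\<bar> \<le> \<bar>p3\<bar>" | "\<bar>p1\<bar> \<le> \<bar>p2\<bar>" "\<bar>p3\<bar> \<le> \<bar>p2\<bar>" | "\<bar>p2\<bar> \<le> \<bar>p1\<bar>" "\<bar>p3\<bar> \<le> \<bar>p1\<bar>"
    by linarith
  note p_cases = this
  consider "\<bar>q1\<bar> \<le> \<bar>q3\<bar>" "\<bar>q2\<bar> \<le> \<bar>q3\<bar>" | "\<bar>q1\<bar> \<le> \<bar>q2\<bar>" "\<bar>q3\<bar> \<le> \<bar>q2\<bar>" | "\<bar>q2\<bar> \<le> \<bar>q1\<bar>" "\<bar>q3\<bar> \<le> \<bar>q1\<bar>"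
    by linarith
  note q_cases = this
  show ?thesis
  proof (cases rule: p_cases)
    case p: 1
    show ?thesis
    proof (cases rule: q_cases)
      case 1
      then show ?thesis using extremal_same_max[OF E] p by blast
    next
      case 2
      then show ?thesis by (intro *[OF E]) (use p in auto)
    next
      case 3
      then show ?thesis by (intro *[OF E12]) (use p in auto)
    qed
  next
    case p: 2
    show ?thesis
    proof (cases rule: q_cases)
      case 1
      then show ?thesis by (intro *[OF E23]) (use p in auto)
    next
      case 2
      then show ?thesis using extremal_same_max[OF E23] p by blast
    next
      case 3
      then show ?thesis by (intro *[OF E132]) (use p in auto)
    qed
  next
    case p: 3
    show ?thesis
    proof (cases rule: q_cases)
      case 1
      then show ?thesis by (intro *[OF E123]) (use p in auto)
    next
      case 2
      then show ?thesis by (intro *[OF E13]) (use p in auto)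
    next
      case 3
      then show ?thesis using extremal_same_max[OF E123] p by blast
    qed
  qed
qed

theorem mainTheorem3:
  shows "admissible parallelogram_A \<and> admissible parallelogram_B \<and>
    (\<forall>\<phi> \<in> hexagon_symmetries. \<phi> ` parallelogram_A \<noteq> parallelogram_B) \<and>
    (\<forall>P. admissible P \<longrightarrow>
       (\<exists>\<phi> \<in> hexagon_symmetries. P = \<phi> ` parallelogram_A \<or> P = \<phi> ` parallelogram_B))"
proof (intro conjI allI impI ballI)
  fix P assume "admissible P"
  then obtain p1 p2 q1 q2 where P: "P = para (lat p1 p2) (lat q1 q2)"
    and E: "extremal p1 p2 (- p1 - p2) q1 q2 (- q1 - q2)"
    by (rule admissible_extremal)
  from extremal_para[OF E] show "\<exists>\<phi>\<in>hexagon_symmetries. P = \<phi> ` parallelogram_A \<or> P = \<phi> ` parallelogram_B"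
    unfolding P .
qed (use admissible_A admissible_B image_A_neq_B in auto)

end
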